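(* Let $d\ge2$ and $l\ge3$ be integers and assume $0<\beta\le L_2$, where $$L_2:=\min\left\{\frac1d\left(1-\sqrt{\frac{d-1}{d^{l/(l-1)}-1}}\right),\ \frac{dl+l^2-2l-d+1}{2dl^2-dl},\ \frac1{1+\sqrt{(d-1)(l-1)}}\right\}.$$ Then $$\sup_{(\rho,\theta)\in\mathcal R_\beta}\Psi_{d,l}(\beta,\rho,\theta)=2\Phi_{d,l}(\beta),$$ and the unique maximizer is $(\rho,\theta)=(\beta^2,\,l(d-1)\beta^2)$. Moreover, the Hessian of $\Psi_{d,l}(\beta,\cdot,\cdot)$ at this point is negative definite and $$r_\beta:=(d-1)(l-1)\left(\frac\beta{1-\beta}\right)^2<1.$$
   Context: For integers $d,l\ge2$ and $0<\beta<1/d$: $$\Phi_{d,l}(\beta)=-\beta\log\beta+(l-1)(1-\beta)\log(1-\beta)-\tfrac ld(1-d\beta)\log(1-d\beta),$$ $$\mathcal R_\beta:=\left\{(\rho,\theta):0<\rho<\beta,\ \max\left\{0,2l\beta-l\rho-\tfrac ld\right\}<\theta<l\beta-l\rho\right\},$$ and for $(\rho,\theta)\in\mathcal R_\beta$, $$\begin{aligned}\Psi_{d,l}(\beta,\rho,\theta)={}&-\rho\log\rho-\theta\log\tfrac\theta l+(l-1)(1-2\beta+\rho)\log(1-2\beta+\rho)+\theta\log(d-1)\\&+2(l-1)(\beta-\rho)\log(\beta-\rho)-2l\left(\beta-\rho-\tfrac\theta l\right)\log\left(\beta-\rho-\tfrac\theta l\right)\\&-\tfrac ld\left(1-2\beta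 d+\rho d+\tfrac{\theta d}l\right)\log\left(1-2\beta d+\rho d+\tfrac{\theta d}l\right).\end{aligned}$$ *)

theory Defs
  imports "HOL-Analysis.Analysis"
begin

definition Phi :: "nat \<Rightarrow> nat \<Rightarrow> real \<Rightarrow> real" where
  "Phi d l \<beta> =
     - \<beta> * ln \<beta> + (real l - 1) * (1 - \<beta>) * ln (1 - \<beta>)
     - real l / real d * (1 - real d * \<beta>) * ln (1 - real d * \<beta>)"

definition R_region :: "nat \<Rightarrow> nat \<Rightarrow> real \<Rightarrow> (real \<times> real) set" where
  "R_region d l \<beta> =
     {(\<rho>, \<theta>). 0 < \<rho> \<and> \<rho> < \<beta> \<and>
        max 0 (2 * real l * \<beta> - real l * \<rho> - real l / real d) < \<theta> \<and>
        \<theta> < real l * \<beta> - real l * \<rho>}"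

definition Psi :: "nat \<Rightarrow> nat \<Rightarrow> real \<Rightarrow> real \<Rightarrow> real \<Rightarrow> real" where
  "Psi d l \<beta> \<rho> \<theta> =
     - \<rho> * ln \<rho> - \<theta> * ln (\<theta> / real l)
     + (real l - 1) * (1 - 2 * \<beta> + \<rho>) * ln (1 - 2 * \<beta> + \<rho>)
     + \<theta> * ln (real d - 1)
     + 2 * (real l - 1) * (\<beta> - \<rho>) * ln (\<beta> - \<rho>)
     - 2 * real l * (\<beta> - \<rho> - \<theta> / real l) * ln (\<beta> - \<rho> - \<theta> / real l)
     - real l / real d
         * (1 - 2 * \<beta> * real d + \<rho> * real d + \<theta> * real d / real l)
         * ln (1 - 2 * \<beta> * real d + \<rho> * real d + \<theta> * real d / real l)"

definition L2 :: "nat \<Rightarrow> nat \<Rightarrow> real" where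
  "L2 d l =
     Min {1 / real d *
            (1 - sqrt ((real d - 1) / (real d powr (real l / (real l - 1)) - 1))),
          (real d * real l + (real l)\<^sup>2 - 2 * real l - real d + 1)
            / (2 * real d * (real l)\<^sup>2 - real d * real l),
          1 / (1 + sqrt ((real d - 1) * (real l - 1)))}"

definition r_param :: "nat \<Rightarrow> nat \<Rightarrow> real \<Rightarrow> real" where
  "r_param d l \<beta> = (real d - 1) * (real l - 1) * (\<beta> / (1 - \<beta>))\<^sup>2"

text \<open>The Hessian is represented by the linear operator \<open>H\<close> with
  \<open>D\<^sup>2 f(x)(u, v) = u \<bullet> H v\<close>, i.e. the total derivative of the gradient at \<open>x\<close>.
  On \<open>real \<times> real\<close> its matrix in the standard basis is the matrix of second-order
  partial derivatives of \<open>f\<close> at \<open>x\<close>.\<close>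

definition has_hessian :: "('a::real_inner \<Rightarrow> real) \<Rightarrow> ('a \<Rightarrow> 'a) \<Rightarrow> 'a \<Rightarrow> bool" where
  "has_hessian f H x \<longleftrightarrow>
     (\<exists>g. (\<forall>\<^sub>F y in nhds x. GDERIV f y :> g y) \<and> (g has_derivative H) (at x))"

definition negative_definite :: "('a::real_inner \<Rightarrow> 'a) \<Rightarrow> bool" where
  "negative_definite H \<longleftrightarrow>
     linear H \<and> (\<forall>u v. u \<bullet> H v = H u \<bullet> v) \<and> (\<forall>v. v \<noteq> 0 \<longrightarrow> v \<bullet> H v < 0)"

end

theory Submission
  imports Defs
begin

text \<open>
  Write \<open>e = d - 1\<close>, \<open>c = 1 - d \<beta>\<close> and \<open>\<mu> = \<beta> / c\<close>. For fixed \<open>\<rho>\<close> the function is strictly concave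
  in \<open>\<theta>\<close>, so the tangent inequality for \<open>x ln x\<close> reduces the problem to the curve of its conditional
  maximizers. That curve is rational: it arises by tilting the pair weights on a clique
  (none, one, two distinct vertices) to \<open>c / (1 + d v)\<close> times \<open>1, v, v\<^sup>2\<close>, with \<open>v = \<mu>\<close> the product measure.
  With \<open>\<delta> = (\<mu> - v) (1 + d v)\<close>, the \<open>\<rho>\<close>-derivative on it is
  \<open>(l - 1) ln (1 + e \<delta> / (1 + e v)\<^sup>2) - ln (1 + \<delta> / v\<^sup>2)\<close>, while \<open>\<rho>\<close> decreases in \<open>v\<close>. The first bound in \<open>L2\<close>
  yields \<open>(1 + e \<mu>) ^ (l - 1) < sqrt d\<close>; this makes the derivative negative for \<open>v < \<mu>\<close> (by convexity
  of powers) and positive for \<open>v > \<mu>\<close> (by Bernoulli), so \<open>v = \<mu>\<close> is the unique maximum. The determinant of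
  the Hessian there is positive exactly when \<open>r_param d l \<beta> < 1\<close>.
\<close>

subsection \<open>Elementary calculus and inequalities\<close>

text \<open>Convexity of the power: between 1 and \<open>1 + y\<close> its graph lies below the
  chord. The induction closes because the mixed term carries \<open>s * s\<close>, which is at most
  \<open>s\<close>.\<close>

lemma power_chord_bound:
  fixes s y :: real
  assumes "0 \<le> s" "s \<le> 1" "0 \<le> y"
  shows "(1 + s * y) ^ m \<le> 1 + s * ((1 + y) ^ m - 1)"
proof (induction m)
  case 0
  then show ?case by simp
next
  case (Suc m)
  define P where "P = (1 + y) ^ m - 1"
  have P: "P \<ge> 0" using assms by (simp add: P_def one_le_power)
  have "(1 + s * y) ^ Suc m \<le> (1 + s * y) * (1 + s * P)"
    using Suc assms by (simp add: P_def mult_left_mono)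
  also have "\<dots> = 1 + s * P + s * y + s * (s * (P * y))" by (simp add: algebra_simps)
  also have "\<dots> \<le> 1 + s * P + s * y + s * (1 * (P * y))"
    using assms P by (intro add_left_mono mult_left_mono mult_right_mono) auto
  also have "\<dots> = 1 + s * ((1 + y) ^ Suc m - 1)" by (simp add: P_def algebra_simps)
  finally show ?case .
qed

text \<open>The left side equals \<open>y * ln y + (ln y + 1) * (x - y)\<close>, the tangent at
  \<open>y\<close> of the convex function \<open>x * ln x\<close>; the inequality is
  \<open>ln z \<le> z - 1\<close> for \<open>z = y / x\<close>.\<close>

lemma mult_ln_tangent:
  fixes x y :: real
  assumes "0 < x" "0 < y"
  shows "x * ln y + x - y \<le> x * ln x"
proof -
  have "ln (y / x) \<le> y / x - 1" using assms by (intro ln_le_minus_one) simp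
  then have "x * ln (y / x) \<le> x * (y / x - 1)" using assms by (intro mult_left_mono) auto
  moreover have "x * (y / x - 1) = y - x" using assms by (simp add: field_simps)
  ultimately show ?thesis using assms by (simp add: ln_div right_diff_distrib)
qed

lemma mult_ln_tangent_strict:
  fixes x y :: real
  assumes "0 < x" "0 < y" "x \<noteq> y"
  shows "x * ln y + x - y < x * ln x"
proof -
  have "ln (y / x) \<noteq> y / x - 1" using ln_eq_minus_one[of "y / x"] assms by auto
  then have "ln (y / x) < y / x - 1" using assms ln_le_minus_one[of "y / x"] by simp
  then have "x * ln (y / x) < x * (y / x - 1)" using assms by (intro mult_strict_left_mono) auto
  moreover have "x * (y / x - 1) = y - x" using assms by (simp add: field_simps)
  ultimately show ?thesis using assms by (simp add: ln_div right_diff_distrib)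
qed

lemma has_derivative_mult_ln:
  fixes X :: "'a::real_normed_vector \<Rightarrow> real"
  assumes "(X has_derivative X') (at p)" "0 < X p"
  shows "((\<lambda>p. X p * ln (X p)) has_derivative (\<lambda>h. X' h * (ln (X p) + 1))) (at p)"
  by (rule derivative_eq_intros assms refl | use assms in \<open>simp add: algebra_simps fun_eq_iff\<close>)+

lemma has_derivative_ln_compose:
  fixes X :: "'a::real_normed_vector \<Rightarrow> real"
  assumes "(X has_derivative X') (at p)" "0 < X p"
  shows "((\<lambda>p. ln (X p)) has_derivative (\<lambda>h. X' h * (1 / X p))) (at p)"
  by (rule derivative_eq_intros assms refl | use assms in \<open>simp add: inverse_eq_divide fun_eq_iff\<close>)+

lemma negative_definite_matrix:
  fixes A B C :: real
  assumes "C < 0" "B\<^sup>2 < A * C"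
  shows "negative_definite (\<lambda>h :: real \<times> real. (A * fst h + B * snd h, B * fst h + C * snd h))"
  unfolding negative_definite_def
proof (intro conjI allI impI)
  show "linear (\<lambda>h :: real \<times> real. (A * fst h + B * snd h, B * fst h + C * snd h))"
    by (rule linearI) (auto simp: algebra_simps)
  show "u \<bullet> (A * fst v + B * snd v, B * fst v + C * snd v)
      = (A * fst u + B * snd u, B * fst u + C * snd u) \<bullet> v" for u v :: "real \<times> real"
    by (simp add: inner_prod_def algebra_simps)
  fix v :: "real \<times> real" assume "v \<noteq> 0"
  obtain x y where v: "v = (x, y)" by (cases v)
  define Q where "Q = A * x\<^sup>2 + 2 * B * x * y + C * y\<^sup>2"
  \<comment> \<open>Multiplying by \<open>C\<close> completes the square without division; as
    \<open>C < 0\<close>, positivity of \<open>C * Q\<close> forces \<open>Q < 0\<close>.\<close>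
  have "C * Q = (C * y + B * x)\<^sup>2 + (A * C - B\<^sup>2) * x\<^sup>2"
    by (simp add: Q_def algebra_simps power2_eq_square)
  also have "\<dots> > 0"
  proof (cases "x = 0")
    case True
    then show ?thesis using \<open>v \<noteq> 0\<close> v assms by (simp add: zero_prod_def)
  next
    case False
    then show ?thesis using assms by (intro add_nonneg_pos mult_pos_pos) auto
  qed
  finally have "Q < 0" using assms(1) by (simp add: zero_less_mult_iff)
  then show "v \<bullet> (A * fst v + B * snd v, B * fst v + C * snd v) < 0"
    by (simp add: v Q_def inner_prod_def algebra_simps power2_eq_square)
qed

text \<open>With \<open>K\<close> and \<open>\<kappa>\<close> as below the claim reads
  \<open>(1 + \<kappa> * K) ^ m < 1 + K\<close>. For large \<open>K\<close> the left side is at most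
  \<open>(1 + e * \<mu>) ^ m\<close>, which is below \<open>sqrt d\<close>; for small
  \<open>K\<close> it lies below the chord from 0 to a threshold \<open>K0\<close>, so the
  inequality at \<open>K0\<close> suffices.\<close>

lemma tilted_ratio_less:
  fixes d e v \<mu> :: real
  assumes d: "2 \<le> d" and e: "e = d - 1" and v: "0 < v" "v < \<mu>"
    and bound: "(1 + e * \<mu>) ^ m < sqrt d"
  shows "(1 + e * ((\<mu> - v) * (1 + d * v)) / (1 + e * v)\<^sup>2) ^ m < 1 + (\<mu> - v) * (1 + d * v) / v\<^sup>2"
proof -
  define \<delta> where "\<delta> = (\<mu> - v) * (1 + d * v)"
  define K where "K = \<delta> / v\<^sup>2"
  \<comment> \<open>The value of \<open>K\<close> at which \<open>1 + K\<close> reaches the bound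
    \<open>sqrt d\<close>.\<close>
  define K0 where "K0 = sqrt d - 1"
  define \<kappa> where "\<kappa> = e * v\<^sup>2 / (1 + e * v)\<^sup>2"
  have e1: "1 \<le> e" using d e by simp
  have ev: "0 < 1 + e * v" using e1 v by (simp add: add_pos_pos)
  have \<delta>: "0 < \<delta>" unfolding \<delta>_def using d v by (intro mult_pos_pos add_pos_pos) auto
  have K: "0 < K" using \<delta> v by (simp add: K_def)
  have "1 < sqrt d" using d by simp
  then have K0: "0 < K0" by (simp add: K0_def)
  have split: "e * \<delta> / (1 + e * v)\<^sup>2 = \<kappa> * K" using v by (simp add: \<kappa>_def K_def)
  have \<kappa>: "0 < \<kappa>" using e1 ev v by (simp add: \<kappa>_def)
  have "(1 + \<kappa> * K) ^ m < 1 + K"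
  proof (cases "K0 \<le> K")
    case True
    \<comment> \<open>The aim is \<open>\<delta> \<le> \<mu> * (1 + e * v)\<^sup>2\<close>, by
      comparing coefficients in \<open>v\<close>; the linear one needs \<open>d \<le> 2 * e\<close>,
      that is \<open>2 \<le> d\<close>.\<close>
    have "\<delta> = \<mu> + (d * \<mu> - 1) * v - d * v\<^sup>2"
      unfolding \<delta>_def by (simp add: algebra_simps power2_eq_square)
    also have "\<dots> \<le> \<mu> + (2 * e * \<mu>) * v + e\<^sup>2 * \<mu> * v\<^sup>2"
    proof -
      have "d * \<mu> \<le> 2 * e * \<mu>" using d e v by (intro mult_right_mono) auto
      then have "(d * \<mu> - 1) * v \<le> (2 * e * \<mu>) * v" using v by (intro mult_right_mono) linarith+
      moreover have "0 \<le> d * v\<^sup>2" "0 \<le> e\<^sup>2 * \<mu> * v\<^sup>2" using d v by auto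
      ultimately show ?thesis by linarith
    qed
    also have "\<dots> = \<mu> * (1 + e * v)\<^sup>2" by (simp add: algebra_simps power2_eq_square)
    finally have "e * \<delta> \<le> e * (\<mu> * (1 + e * v)\<^sup>2)" using e1 by (intro mult_left_mono) auto
    then have "\<kappa> * K \<le> e * \<mu>" unfolding split[symmetric] using ev by (simp add: divide_le_eq mult.assoc)
    then have "(1 + \<kappa> * K) ^ m \<le> (1 + e * \<mu>) ^ m" using \<kappa> K by (intro power_mono) auto
    also have "\<dots> < sqrt d" by (rule bound)
    also have "\<dots> \<le> 1 + K" using True by (simp add: K0_def)
    finally show ?thesis .
  next
    case False
    have "K0 \<le> e"
    proof -
      have "sqrt d \<le> d" using d real_sqrt_le_mono[of d "d\<^sup>2"] by (simp add: power2_eq_square)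
      then show ?thesis using e by (simp add: K0_def)
    qed
    \<comment> \<open>This makes \<open>bound\<close> applicable at the right end of the chord as
      well.\<close>
    have "\<kappa> * K0 \<le> e * \<mu>"
    proof -
      have "v\<^sup>2 * K0 \<le> v\<^sup>2 * e" using \<open>K0 \<le> e\<close> by (intro mult_left_mono) auto
      also have "\<dots> \<le> \<mu> * (e * v)" using v e1 by (simp add: power2_eq_square)
      also have "\<dots> \<le> \<mu> * (1 + e * v)\<^sup>2"
        using v e1 by (intro mult_left_mono) (auto simp: power2_eq_square algebra_simps)
      finally have "e * (v\<^sup>2 * K0) \<le> e * (\<mu> * (1 + e * v)\<^sup>2)" using e1 by (intro mult_left_mono) auto
      then show ?thesis unfolding \<kappa>_def using ev by (simp add: divide_le_eq mult.assoc)
    qed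
    then have top: "(1 + \<kappa> * K0) ^ m < 1 + K0"
      using power_mono[of "1 + \<kappa> * K0" "1 + e * \<mu>" m] \<kappa> K0 bound by (simp add: K0_def)
    have "(1 + \<kappa> * K) ^ m = (1 + (K / K0) * (\<kappa> * K0)) ^ m" using K0 by (simp add: mult.commute)
    also have "\<dots> \<le> 1 + (K / K0) * ((1 + \<kappa> * K0) ^ m - 1)"
      using K K0 \<kappa> False by (intro power_chord_bound) auto
    also have "\<dots> < 1 + (K / K0) * K0"
      using top K K0 by (intro add_strict_left_mono mult_strict_left_mono) auto
    finally show ?thesis using K0 by simp
  qed
  then have "(1 + e * \<delta> / (1 + e * v)\<^sup>2) ^ m < 1 + \<delta> / v\<^sup>2" by (simp only: split K_def)
  then show ?thesis by (simp only: \<delta>_def)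
qed

text \<open>Here \<open>\<delta>\<close> is negative. Bernoulli bounds the power below by a function
  linear in \<open>\<delta>\<close>, so the comparison reduces to the slope inequality
  \<open>m * e * v\<^sup>2 < (1 + e * v)\<^sup>2\<close>.\<close>

lemma tilted_ratio_greater:
  fixes d e v \<mu> :: real
  assumes d: "2 \<le> d" and e: "e = d - 1" and v: "0 < \<mu>" "\<mu> < v"
    and dom: "0 < v\<^sup>2 + (\<mu> - v) * (1 + d * v)"
    and m: "real m * \<mu> \<le> 1"
  shows "1 + (\<mu> - v) * (1 + d * v) / v\<^sup>2 < (1 + e * ((\<mu> - v) * (1 + d * v)) / (1 + e * v)\<^sup>2) ^ m"
proof -
  define \<delta> where "\<delta> = (\<mu> - v) * (1 + d * v)"
  have v0: "0 < v" using v by simp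
  have e1: "1 \<le> e" using d e by simp
  have ev: "0 < 1 + e * v" using e1 v0 by (simp add: add_pos_pos)
  have \<delta>: "\<delta> < 0" unfolding \<delta>_def using d v v0 by (intro mult_neg_pos add_pos_pos) auto
  have dom': "0 < v\<^sup>2 + \<delta>" using dom by (simp add: \<delta>_def)
  \<comment> \<open>If this failed, \<open>dom\<close> multiplied by \<open>m\<close> and combined
    with \<open>m * \<mu> \<le> 1\<close> would give
    \<open>(1 + e * v)\<^sup>2 + m * v \<le> 1 + d * v\<close>, impossible since
    \<open>d \<le> 2 * e\<close>.\<close>
  have slope: "real m * e * v\<^sup>2 < (1 + e * v)\<^sup>2"
  proof (rule ccontr)
    assume "\<not> ?thesis"
    then have 1: "(1 + e * v)\<^sup>2 \<le> real m * e * v\<^sup>2" by simp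
    have "v + e * v\<^sup>2 \<le> \<mu> * (1 + d * v)"
      using dom by (simp add: e algebra_simps power2_eq_square)
    then have "real m * (v + e * v\<^sup>2) \<le> real m * (\<mu> * (1 + d * v))" by (intro mult_left_mono) auto
    also have "\<dots> \<le> 1 * (1 + d * v)"
      unfolding mult.assoc[symmetric] using m d v0 by (intro mult_right_mono) auto
    finally have "(1 + e * v)\<^sup>2 + real m * v \<le> 1 + d * v" using 1 by (simp add: algebra_simps)
    moreover have "(1 + e * v)\<^sup>2 = 1 + 2 * e * v + e\<^sup>2 * v\<^sup>2" by (simp add: algebra_simps power2_eq_square)
    moreover have "d * v \<le> 2 * e * v" using d e v0 by (intro mult_right_mono) auto
    moreover have "0 < e\<^sup>2 * v\<^sup>2" using e1 v0 by simp
    moreover have "0 \<le> real m * v" using v0 by simp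
    ultimately show False by linarith
  qed
  \<comment> \<open>Bernoulli requires an increment of at least -1. It follows from
    \<open>dom\<close>, which bounds \<open>- \<delta>\<close> by \<open>v\<^sup>2\<close>.\<close>
  have "- 1 \<le> e * \<delta> / (1 + e * v)\<^sup>2"
  proof -
    have "e * (- \<delta>) \<le> e * v\<^sup>2" using dom' e1 by (intro mult_left_mono) auto
    also have "\<dots> \<le> e * (e * v\<^sup>2)" using e1 by (intro mult_left_mono) (auto simp: mult_le_cancel_right1)
    also have "\<dots> \<le> (1 + e * v)\<^sup>2" using e1 v0 by (simp add: algebra_simps power2_eq_square)
    finally show ?thesis using ev by (simp add: le_divide_eq)
  qed
  then have "1 + real m * (e * \<delta> / (1 + e * v)\<^sup>2) \<le> (1 + e * \<delta> / (1 + e * v)\<^sup>2) ^ m"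
    by (rule Bernoulli_inequality)
  moreover have "\<delta> / v\<^sup>2 < real m * (e * \<delta> / (1 + e * v)\<^sup>2)"
  proof -
    have "\<delta> * (1 + e * v)\<^sup>2 < \<delta> * (real m * e * v\<^sup>2)"
      using slope \<delta> by (rule mult_strict_left_mono_neg)
    then show ?thesis using ev v0 by (simp add: field_simps)
  qed
  ultimately show ?thesis by (simp add: \<delta>_def)
qed

text \<open>The first entry of the minimum says \<open>sqrt q \<le> c\<close>. Since
  \<open>1 / c = 1 + D * \<mu>\<close>, this is a quadratic inequality in \<open>\<mu>\<close> whose
  left side exceeds \<open>(1 + e * \<mu>)\<^sup>2\<close> by \<open>e * \<mu>\<^sup>2\<close>.
  Hence \<open>(1 + e * \<mu>)\<^sup>2 < a\<close>, and raising to the power \<open>m\<close> gives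
  the claim.\<close>

lemma L2_tilt_bound:
  fixes d l :: nat and \<beta> :: real
  assumes "d \<ge> 2" "l \<ge> 3" "0 < \<beta>" "\<beta> \<le> L2 d l"
  shows "real d * \<beta> < 1"
    and "(1 + (real d - 1) * (\<beta> / (1 - real d * \<beta>))) ^ (l - 1) < sqrt (real d)"
proof -
  define D where "D = real d"
  define e where "e = D - 1"
  define m where "m = l - 1"
  \<comment> \<open>As \<open>l / (l - 1) = 1 + 1 / m\<close>, the power of \<open>d\<close> in
    \<open>L2\<close> is \<open>D * a\<close>, with \<open>a ^ m = D\<close>.\<close>
  define a where "a = D powr (1 / real m)"
  define q where "q = e / (D * a - 1)"
  have D: "2 \<le> D" and e: "1 \<le> e" using assms by (auto simp: D_def e_def)
  have m: "m \<ge> 2" "real l = real m + 1" using assms by (auto simp: m_def)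
  have "real l / (real l - 1) = 1 + 1 / real m" using m by (simp add: field_simps)
  then have pw: "real d powr (real l / (real l - 1)) = D * a"
    using D by (simp add: D_def a_def powr_add)
  have a: "1 < a" unfolding a_def using D m by (intro gr_one_powr) auto
  have "e < D * a - 1" using a D by (simp add: e_def)
  then have q: "0 < q" using e by (simp add: q_def)
  have "\<beta> \<le> 1 / D * (1 - sqrt q)"
    using assms(4) pw unfolding L2_def q_def e_def D_def by simp
  then have b: "sqrt q \<le> 1 - D * \<beta>" using D by (simp add: field_simps)
  define c where "c = 1 - D * \<beta>"
  have c: "0 < c" using b q unfolding c_def by (smt (verit) real_sqrt_gt_zero)
  then show "real d * \<beta> < 1" by (simp add: c_def D_def)
  have "q \<le> c\<^sup>2" using b q real_sqrt_le_iff[of q "c\<^sup>2"] c by (simp add: c_def[symmetric])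
  then have "e \<le> c\<^sup>2 * (D * a - 1)"
    using \<open>e < D * a - 1\<close> e by (simp add: q_def divide_le_eq)
  define \<mu> where "\<mu> = \<beta> / c"
  have \<mu>: "0 < \<mu>" using assms c by (simp add: \<mu>_def)
  have "1 / c = 1 + D * \<mu>" using c by (simp add: \<mu>_def c_def field_simps)
  then have "e * (1 + D * \<mu>)\<^sup>2 = e / c\<^sup>2" by (simp flip: \<open>1 / c = 1 + D * \<mu>\<close> add: power_one_over)
  also have "\<dots> \<le> D * a - 1" using \<open>e \<le> c\<^sup>2 * (D * a - 1)\<close> c by (simp add: divide_le_eq mult.commute)
  \<comment> \<open>Moving the 1 to the left lets a factor \<open>D = e + 1\<close> come
    out.\<close>
  finally have "D * (1 + 2 * e * \<mu> + e * D * \<mu>\<^sup>2) \<le> D * a"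
    by (simp add: e_def algebra_simps power2_eq_square)
  then have *: "1 + 2 * e * \<mu> + e * D * \<mu>\<^sup>2 \<le> a" using D by simp
  have "0 < e * \<mu>\<^sup>2" using e \<mu> by simp
  then have "(1 + e * \<mu>)\<^sup>2 < a" using * by (simp add: e_def algebra_simps power2_eq_square)
  then have "((1 + e * \<mu>)\<^sup>2) ^ m < a ^ m" using m by (intro power_strict_mono) auto
  also have "a ^ m = D" using D m by (simp add: a_def powr_realpow[symmetric] powr_powr)
  finally have "((1 + e * \<mu>) ^ m)\<^sup>2 < D" by (simp add: power_mult[symmetric] mult.commute)
  then have "(1 + e * \<mu>) ^ m < sqrt D" by (rule real_less_rsqrt)
  then show "(1 + (real d - 1) * (\<beta> / (1 - real d * \<beta>))) ^ (l - 1) < sqrt (real d)"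
    by (simp add: e_def D_def \<mu>_def c_def m_def)
qed

subsection \<open>Reduction to a curve\<close>

locale overlap_optimization =
  fixes d l :: nat and \<beta> :: real
  assumes d: "2 \<le> d" and l: "3 \<le> l" and \<beta>_pos: "0 < \<beta>" and d\<beta>: "real d * \<beta> < 1"
begin

section \<open>Coordinates, gradient and the curve of conditional maximizers\<close>

definition e :: real where "e = real d - 1"
definition c :: real where "c = 1 - real d * \<beta>"
definition \<mu> :: real where "\<mu> = \<beta> / c"

text \<open>Together with \<open>free\<close> it satisfies
  \<open>free p + 2 * d * gap p + d * \<rho> + d * \<theta> / l = 1\<close>: the weights with which
  a pair of sets meets a clique in nothing, in a vertex of just one set (for either set), in a
  common vertex, or in two distinct vertices.\<close>

definition gap :: "real \<times> real \<Rightarrow> real" where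
  "gap p = \<beta> - fst p - snd p / real l"

definition free :: "real \<times> real \<Rightarrow> real" where
  "free p = 1 - 2 * \<beta> * real d + fst p * real d + snd p * real d / real l"

definition psi :: "real \<times> real \<Rightarrow> real" where
  "psi p = Psi d l \<beta> (fst p) (snd p)"

text \<open>The constants from the derivative \<open>ln x + 1\<close> of \<open>x * ln x\<close>
  cancel in both components, which leaves only logarithms.\<close>

definition grad :: "real \<times> real \<Rightarrow> real \<times> real" where
  "grad p =
    (- ln (fst p) + (real l - 1) * ln (1 - 2 * \<beta> + fst p) - 2 * (real l - 1) * ln (\<beta> - fst p)
       + 2 * real l * ln (gap p) - real l * ln (free p),
     ln e - ln (snd p / real l) + 2 * ln (gap p) - ln (free p))"

text \<open>The second component counts \<open>e\<close> partners of weight \<open>v\<^sup>2\<close>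
  for each vertex; the first is then forced by the marginal identity
  \<open>\<beta> - \<rho> = gap + \<theta> / l\<close>.\<close>

definition curve :: "real \<Rightarrow> real \<times> real" where
  "curve v = (\<beta> - c * v * (1 + e * v) / (1 + real d * v), real l * (c * e * v\<^sup>2 / (1 + real d * v)))"

lemma e_ge: "1 \<le> e" and d_eq: "real d = e + 1" and d_pos: "0 < real d" and l_pos: "0 < real l"
  using d l by (auto simp: e_def)

lemma c_pos: "0 < c" and \<mu>_pos: "0 < \<mu>"
  using d\<beta> \<beta>_pos by (auto simp: c_def \<mu>_def)

lemma \<beta>_eq: "\<beta> = c * \<mu>" and c_\<mu>: "c * (1 + real d * \<mu>) = 1"
proof -
  show "\<beta> = c * \<mu>" using c_pos by (simp add: \<mu>_def)
  then show "c * (1 + real d * \<mu>) = 1" using c_def by (metis add_diff_cancel_left' diff_add_cancel distrib_left mult.commute mult.left_commute mult_1)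
qed

lemma \<beta>_le_half: "2 * \<beta> < 1"
proof -
  have "2 * \<beta> \<le> real d * \<beta>" using d \<beta>_pos by (intro mult_right_mono) auto
  then show ?thesis using d\<beta> by simp
qed

text \<open>In this form the constraints are positivity of the arguments of the logarithms;
  \<open>1 - 2 * \<beta> + \<rho> > 0\<close> comes from \<open>\<beta>_le_half\<close>.\<close>

lemma region_iff:
  "p \<in> R_region d l \<beta> \<longleftrightarrow> 0 < fst p \<and> fst p < \<beta> \<and> 0 < snd p \<and> 0 < gap p \<and> 0 < free p"
proof -
  have "real l / real d * free p = snd p - (2 * real l * \<beta> - real l * fst p - real l / real d)"
    using d_pos l_pos unfolding free_def by (simp add: field_simps)
  then have "2 * real l * \<beta> - real l * fst p - real l / real d < snd p \<longleftrightarrow>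
      real l / real d * free p > 0"
    by auto
  also have "\<dots> \<longleftrightarrow> 0 < free p" using d_pos l_pos by (simp add: zero_less_divide_iff zero_less_mult_iff)
  finally have 1: "2 * real l * \<beta> - real l * fst p - real l / real d < snd p \<longleftrightarrow> 0 < free p" .
  have 2: "snd p < real l * \<beta> - real l * fst p \<longleftrightarrow> 0 < gap p"
    using l_pos unfolding gap_def by (simp add: field_simps)
  show ?thesis using 1 2 by (cases p) (auto simp: R_region_def)
qed

lemma open_region: "open (R_region d l \<beta>)"
proof -
  have "R_region d l \<beta> = {p. 0 < fst p} \<inter> {p. fst p < \<beta>} \<inter> {p. 0 < snd p} \<inter> {p. 0 < gap p} \<inter> {p. 0 < free p}"
    using region_iff by auto
  moreover have "open \<dots>" unfolding gap_def free_def
    using l_pos by (intro open_Int open_Collect_less continuous_intros) auto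
  ultimately show ?thesis by simp
qed

lemma psi_eq:
  "psi p = - (fst p * ln (fst p)) - real l * (snd p / real l * ln (snd p / real l))
    + (real l - 1) * ((1 - 2 * \<beta> + fst p) * ln (1 - 2 * \<beta> + fst p)) + ln e * snd p
    + 2 * (real l - 1) * ((\<beta> - fst p) * ln (\<beta> - fst p)) - 2 * real l * (gap p * ln (gap p))
    - real l / real d * (free p * ln (free p))"
  using l_pos by (simp add: psi_def Psi_def gap_def free_def e_def)

lemma has_derivative_gap: "(gap has_derivative (\<lambda>h. - fst h - snd h / real l)) (at p)"
  unfolding gap_def [abs_def] using l_pos by (auto intro!: derivative_eq_intros)

lemma has_derivative_free:
  "(free has_derivative (\<lambda>h. fst h * real d + snd h * real d / real l)) (at p)"
  unfolding free_def [abs_def] using l_pos by (auto intro!: derivative_eq_intros)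

lemma has_derivative_psi:
  assumes "p \<in> R_region d l \<beta>"
  shows "(psi has_derivative (\<lambda>h. h \<bullet> grad p)) (at p)"
proof -
  have pos: "0 < fst p" "fst p < \<beta>" "0 < snd p" "0 < gap p" "0 < free p"
    using assms by (auto simp: region_iff)
  have t1: "((\<lambda>p. fst p * ln (fst p)) has_derivative (\<lambda>h. fst h * (ln (fst p) + 1))) (at p)"
    using pos by (intro has_derivative_mult_ln) (auto intro!: derivative_eq_intros)
  have t2: "((\<lambda>p. snd p / real l * ln (snd p / real l)) has_derivative
      (\<lambda>h. snd h / real l * (ln (snd p / real l) + 1))) (at p)"
    using pos l_pos by (intro has_derivative_mult_ln[where X = "\<lambda>p. snd p / real l"])
      (auto intro!: derivative_eq_intros)
  have t3: "((\<lambda>p. (1 - 2 * \<beta> + fst p) * ln (1 - 2 * \<beta> + fst p)) has_derivative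
      (\<lambda>h. fst h * (ln (1 - 2 * \<beta> + fst p) + 1))) (at p)"
    using pos \<beta>_le_half by (intro has_derivative_mult_ln) (auto intro!: derivative_eq_intros)
  have t4: "((\<lambda>p. (\<beta> - fst p) * ln (\<beta> - fst p)) has_derivative
      (\<lambda>h. - fst h * (ln (\<beta> - fst p) + 1))) (at p)"
    using pos by (intro has_derivative_mult_ln) (auto intro!: derivative_eq_intros)
  note t5 = has_derivative_mult_ln[OF has_derivative_gap pos(4)]
  note t6 = has_derivative_mult_ln[OF has_derivative_free pos(5)]
  have "(psi has_derivative (\<lambda>h. - (fst h * (ln (fst p) + 1))
      - real l * (snd h / real l * (ln (snd p / real l) + 1))
      + (real l - 1) * (fst h * (ln (1 - 2 * \<beta> + fst p) + 1)) + ln e * snd h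
      + 2 * (real l - 1) * (- fst h * (ln (\<beta> - fst p) + 1))
      - 2 * real l * ((- fst h - snd h / real l) * (ln (gap p) + 1))
      - real l / real d * ((fst h * real d + snd h * real d / real l) * (ln (free p) + 1)))) (at p)"
    unfolding psi_eq[abs_def]
    by (intro has_derivative_add has_derivative_diff has_derivative_minus has_derivative_mult_right
        t1 t2 t3 t4 t5 t6 has_derivative_snd has_derivative_ident)
  moreover have "(\<lambda>h. - (fst h * (ln (fst p) + 1))
      - real l * (snd h / real l * (ln (snd p / real l) + 1))
      + (real l - 1) * (fst h * (ln (1 - 2 * \<beta> + fst p) + 1)) + ln e * snd h
      + 2 * (real l - 1) * (- fst h * (ln (\<beta> - fst p) + 1))
      - 2 * real l * ((- fst h - snd h / real l) * (ln (gap p) + 1))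
      - real l / real d * ((fst h * real d + snd h * real d / real l) * (ln (free p) + 1)))
    = (\<lambda>h. h \<bullet> grad p)"
  proof
    fix h :: "real \<times> real"
    have 1: "real l * (snd h / real l * (ln (snd p / real l) + 1)) = snd h * (ln (snd p / real l) + 1)"
      using l_pos by simp
    have 2: "2 * real l * ((- fst h - snd h / real l) * (ln (gap p) + 1))
        = 2 * ((- real l * fst h - snd h) * (ln (gap p) + 1))"
      using l_pos by (simp add: field_simps)
    have 3: "real l / real d * ((fst h * real d + snd h * real d / real l) * (ln (free p) + 1))
        = (real l * fst h + snd h) * (ln (free p) + 1)"
      using l_pos d_pos by (simp add: field_simps)
    show "- (fst h * (ln (fst p) + 1))
      - real l * (snd h / real l * (ln (snd p / real l) + 1))
      + (real l - 1) * (fst h * (ln (1 - 2 * \<beta> + fst p) + 1)) + ln e * snd h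
      + 2 * (real l - 1) * (- fst h * (ln (\<beta> - fst p) + 1))
      - 2 * real l * ((- fst h - snd h / real l) * (ln (gap p) + 1))
      - real l / real d * ((fst h * real d + snd h * real d / real l) * (ln (free p) + 1))
      = h \<bullet> grad p"
      unfolding 1 2 3 by (cases h) (simp add: grad_def inner_prod_def algebra_simps)
  qed
  ultimately show ?thesis by simp
qed

lemma psi_split:
  "psi p = (- (fst p * ln (fst p)) + (real l - 1) * ((1 - 2 * \<beta> + fst p) * ln (1 - 2 * \<beta> + fst p))
      + 2 * (real l - 1) * ((\<beta> - fst p) * ln (\<beta> - fst p)))
    + real l * (- (snd p / real l * ln (snd p / real l)) + ln e * (snd p / real l)
      - 2 * (gap p * ln (gap p)) - free p * ln (free p) / real d)"
proof -
  have "ln e * snd p = real l * (ln e * (snd p / real l))" using l_pos by simp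
  then show ?thesis unfolding psi_eq by (simp add: right_diff_distrib distrib_left)
qed

text \<open>For fixed \<open>\<rho>\<close> each entropy term is bounded by its tangent at
  \<open>q\<close>, and criticality cancels the first-order terms. Strictness comes from the term in
  \<open>\<theta>\<close>.\<close>

lemma psi_less_critical:
  assumes p: "p \<in> R_region d l \<beta>" and q: "q \<in> R_region d l \<beta>"
    and same: "fst p = fst q" and crit: "snd (grad q) = 0" and neq: "p \<noteq> q"
  shows "psi p < psi q"
proof -
  define t t' where "t = snd p / real l" and "t' = snd q / real l"
  have pos: "0 < t" "0 < t'" "0 < gap p" "0 < gap q" "0 < free p" "0 < free q"
    using p q l_pos by (auto simp: region_iff t_def t'_def)
  have "t \<noteq> t'" using same neq l_pos by (auto simp: t_def t'_def prod_eq_iff)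
  have gap: "gap p = gap q - (t - t')" using same by (simp add: gap_def t_def t'_def)
  have free: "free p = free q + real d * (t - t')"
    using same by (simp add: free_def t_def t'_def algebra_simps)
  have snd: "snd p = real l * t" "snd q = real l * t'" using l_pos by (auto simp: t_def t'_def)
  have 1: "t * ln t' + t - t' < t * ln t"
    using pos \<open>t \<noteq> t'\<close> by (intro mult_ln_tangent_strict)
  have 2: "gap p * ln (gap q) + gap p - gap q \<le> gap p * ln (gap p)"
    using pos by (intro mult_ln_tangent)
  have "free p * ln (free q) + free p - free q \<le> free p * ln (free p)"
    using pos by (intro mult_ln_tangent)
  then have 3: "(free p * ln (free q) + free p - free q) / real d \<le> (free p * ln (free p)) / real d"
    using d_pos by (intro divide_right_mono) auto
  have "(free p * ln (free q) + free p - free q) / real d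
      = free q * ln (free q) / real d + (t - t') * ln (free q) + (t - t')"
    using d_pos unfolding free by (simp add: field_simps)
  note 3 = 3[unfolded this]
  have crit': "ln t' = ln e + 2 * ln (gap q) - ln (free q)" using crit by (simp add: grad_def t'_def)
  have "gap p * ln (gap q) + gap p - gap q = gap q * ln (gap q) - (t - t') * ln (gap q) - (t - t')"
    unfolding gap by (simp add: algebra_simps)
  note 2 = 2[unfolded this]
  have sum: "- a' + x - 2 * b' - z' < - a + x - 2 * b - z" if "a < a'" "b \<le> b'" "z \<le> z'"
    for a a' b b' z z' x :: real using that by linarith
  have "- (t * ln t) + ln e * t - 2 * (gap p * ln (gap p)) - free p * ln (free p) / real d
      < - (t * ln t' + t - t') + ln e * t - 2 * (gap q * ln (gap q) - (t - t') * ln (gap q) - (t - t'))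
        - (free q * ln (free q) / real d + (t - t') * ln (free q) + (t - t'))"
    by (rule sum[OF 1 2 3])
  \<comment> \<open>All terms in \<open>t - t'\<close> vanish: the logarithmic ones by
    \<open>crit'\<close>, the others because their coefficients are -1, 2 and -1.\<close>
  also have "\<dots> = - (t' * ln t') + ln e * t' - 2 * (gap q * ln (gap q)) - free q * ln (free q) / real d"
    unfolding crit' by (simp add: algebra_simps)
  finally have "real l * (- (t * ln t) + ln e * t - 2 * (gap p * ln (gap p)) - free p * ln (free p) / real d)
    < real l * (- (t' * ln t') + ln e * t' - 2 * (gap q * ln (gap q)) - free q * ln (free q) / real d)"
    using l_pos by (rule mult_strict_left_mono)
  then show ?thesis
    unfolding psi_split[of p] psi_split[of q] t_def[symmetric] t'_def[symmetric] same by simp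
qed

section \<open>Explicit values and derivative along the curve\<close>

context
  fixes v :: real
  assumes v: "0 < v"
begin

lemma denominator_pos: "0 < 1 + real d * v" "0 < 1 + e * v"
  using v d_pos e_ge by (auto intro!: add_pos_pos)

lemma gap_curve: "gap (curve v) = c * v / (1 + real d * v)"
proof -
  have "gap (curve v) = c * v * (1 + e * v) / (1 + real d * v) - c * e * v\<^sup>2 / (1 + real d * v)"
    using l_pos by (simp add: gap_def curve_def)
  also have "\<dots> = (c * v * (1 + e * v) - c * e * v\<^sup>2) / (1 + real d * v)"
    by (rule diff_divide_distrib[symmetric])
  also have "c * v * (1 + e * v) - c * e * v\<^sup>2 = c * v"
    by (simp add: algebra_simps power2_eq_square)
  finally show ?thesis .
qed

lemma free_curve: "free (curve v) = c / (1 + real d * v)"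
proof -
  have "free (curve v) = c - real d * gap (curve v)"
    by (simp add: free_def gap_def c_def algebra_simps)
  also have "\<dots> = c / (1 + real d * v)"
    unfolding gap_curve using denominator_pos by (simp add: field_simps)
  finally show ?thesis .
qed

text \<open>The term \<open>v\<^sup>2\<close> is the weight of a coincident pair under the same
  tilting; the rest is the defect \<open>c * (\<mu> - v)\<close>, which vanishes only at the product
  point.\<close>

lemma fst_curve: "fst (curve v) = c * (v\<^sup>2 + (\<mu> - v) * (1 + real d * v)) / (1 + real d * v)"
proof -
  have "fst (curve v) = (c * \<mu> * (1 + real d * v) - c * v * (1 + e * v)) / (1 + real d * v)"
    using denominator_pos by (simp add: curve_def diff_divide_distrib \<beta>_eq[symmetric])
  also have "c * \<mu> * (1 + real d * v) - c * v * (1 + e * v) = c * (v\<^sup>2 + (\<mu> - v) * (1 + real d * v))"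
    unfolding d_eq by (simp add: algebra_simps power2_eq_square)
  finally show ?thesis .
qed

lemma none_curve:
  "1 - 2 * \<beta> + fst (curve v)
    = c * ((1 + e * v)\<^sup>2 + e * ((\<mu> - v) * (1 + real d * v))) / (1 + real d * v)"
proof -
  have "1 - \<beta> = c * (1 + e * \<mu>)"
    using c_\<mu> unfolding d_eq by (subst \<beta>_eq) (simp add: algebra_simps)
  then have "1 - 2 * \<beta> + fst (curve v)
      = (c * (1 + e * \<mu>) * (1 + real d * v) - c * v * (1 + e * v)) / (1 + real d * v)"
    using denominator_pos by (simp add: curve_def diff_divide_distrib)
  also have "c * (1 + e * \<mu>) * (1 + real d * v) - c * v * (1 + e * v)
      = c * ((1 + e * v)\<^sup>2 + e * ((\<mu> - v) * (1 + real d * v)))"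
    unfolding d_eq by (simp add: algebra_simps power2_eq_square)
  finally show ?thesis .
qed

text \<open>On the curve every constraint except \<open>\<rho> > 0\<close> holds
  automatically.\<close>

lemma curve_in_region_iff:
  "curve v \<in> R_region d l \<beta> \<longleftrightarrow> 0 < v\<^sup>2 + (\<mu> - v) * (1 + real d * v)"
proof -
  have "0 < c * v * (1 + e * v) / (1 + real d * v)" "0 < c * v / (1 + real d * v)"
      "0 < c / (1 + real d * v)" "0 < real l * (c * e * v\<^sup>2 / (1 + real d * v))"
    using denominator_pos c_pos v e_ge l_pos by auto
  then have "curve v \<in> R_region d l \<beta> \<longleftrightarrow> 0 < fst (curve v)"
    unfolding region_iff gap_curve free_curve by (auto simp: curve_def)
  also have "\<dots> \<longleftrightarrow> 0 < v\<^sup>2 + (\<mu> - v) * (1 + real d * v)"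
    unfolding fst_curve using c_pos denominator_pos by (simp add: zero_less_divide_iff zero_less_mult_iff)
  finally show ?thesis .
qed

text \<open>Every argument of a logarithm carries the factor \<open>c / w\<close>. The coefficients
  of \<open>ln c\<close> and \<open>ln w\<close> sum to zero, so only the two ratios survive in the
  first component and nothing in the second.\<close>

lemma grad_curve:
  assumes "curve v \<in> R_region d l \<beta>"
  defines "\<delta> \<equiv> (\<mu> - v) * (1 + real d * v)"
  shows "fst (grad (curve v)) = real (l - 1) * ln (1 + e * \<delta> / (1 + e * v)\<^sup>2) - ln (1 + \<delta> / v\<^sup>2)"
    and "snd (grad (curve v)) = 0"
proof -
  note pos = denominator_pos c_pos v
  define w where "w = 1 + real d * v"
  have dom: "0 < v\<^sup>2 + \<delta>" using assms curve_in_region_iff by simp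
  have "0 < 1 - 2 * \<beta> + fst (curve v)" using assms \<beta>_le_half by (auto simp: region_iff)
  then have dom': "0 < (1 + e * v)\<^sup>2 + e * \<delta>"
    using pos unfolding none_curve \<delta>_def[symmetric] by (simp add: zero_less_divide_iff zero_less_mult_iff)
  have w: "0 < w" and \<delta>: "(\<mu> - v) * w = \<delta>" using pos by (simp_all add: w_def \<delta>_def)
  have f1: "ln (fst (curve v)) = ln c + ln (v\<^sup>2 + \<delta>) - ln w"
    unfolding fst_curve using pos dom w by (simp add: ln_div ln_mult w_def[symmetric] \<delta>)
  have f2: "ln (1 - 2 * \<beta> + fst (curve v)) = ln c + ln ((1 + e * v)\<^sup>2 + e * \<delta>) - ln w"
    unfolding none_curve using pos dom' w by (simp add: ln_div ln_mult w_def[symmetric] \<delta>)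
  have f3: "ln (\<beta> - fst (curve v)) = ln c + ln v + ln (1 + e * v) - ln w"
    using pos w by (simp add: curve_def ln_div ln_mult w_def[symmetric])
  have f4: "ln (gap (curve v)) = ln c + ln v - ln w"
    unfolding gap_curve using pos w by (simp add: ln_div ln_mult w_def[symmetric])
  have f5: "ln (free (curve v)) = ln c - ln w"
    unfolding free_curve using pos w by (simp add: ln_div w_def[symmetric])
  have f6: "ln (snd (curve v) / real l) = ln c + ln e + 2 * ln v - ln w"
    using pos w e_ge l_pos by (simp add: curve_def ln_div ln_mult ln_realpow w_def[symmetric])
  have g1: "ln (1 + \<delta> / v\<^sup>2) = ln (v\<^sup>2 + \<delta>) - 2 * ln v"
  proof -
    have "1 + \<delta> / v\<^sup>2 = (v\<^sup>2 + \<delta>) / v\<^sup>2" using pos by (simp add: field_simps)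
    then show ?thesis using pos dom by (simp add: ln_div ln_realpow)
  qed
  have g2: "ln (1 + e * \<delta> / (1 + e * v)\<^sup>2) = ln ((1 + e * v)\<^sup>2 + e * \<delta>) - 2 * ln (1 + e * v)"
  proof -
    have "1 + e * \<delta> / (1 + e * v)\<^sup>2 = ((1 + e * v)\<^sup>2 + e * \<delta>) / (1 + e * v)\<^sup>2"
      using pos by (simp add: add_divide_distrib)
    then show ?thesis using pos dom' by (simp add: ln_div ln_realpow)
  qed
  have m: "real (l - 1) = real l - 1" using l by simp
  show "fst (grad (curve v)) = real (l - 1) * ln (1 + e * \<delta> / (1 + e * v)\<^sup>2) - ln (1 + \<delta> / v\<^sup>2)"
    unfolding g1 g2 m grad_def fst_conv f1 f2 f3 f4 f5 by (simp add: algebra_simps)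
  show "snd (grad (curve v)) = 0"
    unfolding grad_def snd_conv f4 f5 f6 by (simp add: algebra_simps)
qed

lemma has_real_derivative_psi_curve:
  assumes "curve v \<in> R_region d l \<beta>"
  shows "((\<lambda>v. psi (curve v)) has_real_derivative
    - (c * (1 + 2 * e * v + e * real d * v\<^sup>2) / (1 + real d * v)\<^sup>2) * fst (grad (curve v))) (at v)"
proof -
  define y where "y = - (c * (1 + 2 * e * v + e * real d * v\<^sup>2) / (1 + real d * v)\<^sup>2)"
  \<comment> \<open>The speed in the \<open>\<theta>\<close> direction may stay anonymous, since it
    multiplies the vanishing component of the gradient.\<close>
  obtain z where z: "((\<lambda>v. real l * (c * e * v\<^sup>2 / (1 + real d * v))) has_real_derivative z) (at v)"
    using denominator_pos by (atomize_elim) (rule exI, (rule derivative_eq_intros refl | simp)+)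
  have "((\<lambda>v. \<beta> - c * v * (1 + e * v) / (1 + real d * v)) has_real_derivative y) (at v)"
    using denominator_pos unfolding y_def
    by (auto intro!: derivative_eq_intros simp: field_simps power2_eq_square)
  with z have "(curve has_derivative (\<lambda>h. (y * h, z * h))) (at v)"
    unfolding curve_def[abs_def] has_field_derivative_def by (intro has_derivative_Pair)
  from diff_chain_at[OF this has_derivative_psi[OF assms]]
  have "((\<lambda>v. psi (curve v)) has_derivative (\<lambda>h. (y * h, z * h) \<bullet> grad (curve v))) (at v)"
    by (simp add: o_def)
  moreover have "(y * h, z * h) \<bullet> grad (curve v) = y * fst (grad (curve v)) * h" for h
    by (simp add: inner_prod_def grad_curve(2)[OF assms])
  ultimately show ?thesis unfolding has_field_derivative_def y_def[symmetric] by simp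
qed

end

lemma curve_\<mu>: "curve \<mu> = (\<beta>\<^sup>2, real l * e * \<beta>\<^sup>2)"
proof -
  have c: "1 / (1 + real d * \<mu>) = c" using c_\<mu> by (metis mult.commute nonzero_divide_eq_eq mult_zero_left zero_neq_one)
  have \<beta>2: "\<beta>\<^sup>2 = c\<^sup>2 * \<mu>\<^sup>2" by (metis \<beta>_eq power_mult_distrib)
  have "fst (curve \<mu>) = (c * \<mu>\<^sup>2) * (1 / (1 + real d * \<mu>))" using fst_curve[OF \<mu>_pos] by simp
  also have "\<dots> = \<beta>\<^sup>2" unfolding c \<beta>2 by (simp add: power2_eq_square)
  finally have 1: "fst (curve \<mu>) = \<beta>\<^sup>2" .
  have "snd (curve \<mu>) = real l * (c * e * \<mu>\<^sup>2) * (1 / (1 + real d * \<mu>))" by (simp add: curve_def)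
  also have "\<dots> = real l * e * \<beta>\<^sup>2" unfolding c \<beta>2 by (simp add: power2_eq_square)
  finally show ?thesis using 1 by (simp add: prod_eq_iff)
qed

lemma curve_\<mu>_in_region: "curve \<mu> \<in> R_region d l \<beta>"
  using curve_in_region_iff[OF \<mu>_pos] \<mu>_pos by simp

text \<open>Intermediate value theorem for \<open>\<beta> - \<rho>\<close> along the curve: it
  starts at 0 and is at least \<open>(c * e / d) * v\<close>.\<close>

lemma ex_curve:
  assumes "p \<in> R_region d l \<beta>"
  shows "\<exists>v>0. fst (curve v) = fst p"
proof -
  define s where "s = \<beta> - fst p"
  have s: "0 < s" using assms by (simp add: s_def region_iff)
  define h where "h v = c * v * (1 + e * v) / (1 + real d * v)" for v
  \<comment> \<open>Chosen so that the linear lower bound already equals \<open>s\<close> at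
    \<open>V\<close>.\<close>
  define V where "V = real d * s / (c * e)"
  have V: "0 < V" using s c_pos e_ge d_pos by (simp add: V_def)
  have "s \<le> h V"
  proof -
    have "e * (1 + real d * V) \<le> real d * (1 + e * V)" by (simp add: d_eq algebra_simps)
    then have "c * V * (e * (1 + real d * V)) \<le> c * V * (real d * (1 + e * V))"
      using c_pos V by (intro mult_left_mono) auto
    moreover have "c * V * e = real d * s" using c_pos e_ge by (simp add: V_def)
    ultimately have "real d * (s * (1 + real d * V)) \<le> real d * (c * V * (1 + e * V))"
      by (metis mult.assoc mult.left_commute)
    then have "s * (1 + real d * V) \<le> c * V * (1 + e * V)" using d_pos by simp
    then show ?thesis unfolding h_def using denominator_pos(1)[OF V] by (simp add: le_divide_eq)
  qed
  moreover have "h 0 \<le> s" using s by (simp add: h_def)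
  moreover have "continuous_on {0..V} h" unfolding h_def
    using d_pos by (intro continuous_intros ballI) (auto simp: add_pos_nonneg less_imp_neq[symmetric])
  ultimately obtain v where v: "0 \<le> v" "v \<le> V" "h v = s"
    using IVT'[of h 0 s V] V by auto
  then have "v \<noteq> 0" using s by (auto simp: h_def)
  with v show ?thesis by (intro exI[of _ v]) (auto simp: curve_def h_def s_def)
qed

subsection \<open>The Hessian at the product point\<close>

text \<open>At the product point all six arguments are monomials in \<open>\<beta>\<close>,
  \<open>x\<close>, \<open>c\<close> and \<open>e\<close>. Collecting the coefficients of each
  logarithm recovers the one-set marginals, and \<open>ln e\<close> cancels.\<close>

lemma psi_curve_\<mu>: "psi (curve \<mu>) = 2 * Phi d l \<beta>"
proof -
  define x where "x = 1 - \<beta>"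
  have x: "0 < x" using \<beta>_le_half \<beta>_pos by (simp add: x_def)
  have e: "0 < e" using e_ge by simp
  have c: "real d * \<beta> = 1 - c" by (simp add: c_def)
  have snd: "snd (curve \<mu>) / real l = e * \<beta>\<^sup>2" and fst: "fst (curve \<mu>) = \<beta>\<^sup>2"
    using l_pos by (simp_all add: curve_\<mu>)
  have none: "1 - 2 * \<beta> + \<beta>\<^sup>2 = x\<^sup>2" by (simp add: x_def power2_eq_square algebra_simps)
  have single: "\<beta> - \<beta>\<^sup>2 = \<beta> * x" by (simp add: x_def power2_eq_square algebra_simps)
  have gap: "gap (curve \<mu>) = \<beta> * c"
    unfolding gap_def fst snd by (simp add: c_def d_eq algebra_simps power2_eq_square)
  have "free (curve \<mu>) = c - real d * gap (curve \<mu>)"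
    by (simp add: free_def gap_def c_def algebra_simps)
  also have "\<dots> = c - (real d * \<beta>) * c" by (simp add: gap)
  also have "\<dots> = c\<^sup>2" unfolding c by (simp add: algebra_simps power2_eq_square)
  finally have free: "free (curve \<mu>) = c\<^sup>2" .
  have ln: "ln (\<beta>\<^sup>2) = 2 * ln \<beta>" "ln (x\<^sup>2) = 2 * ln x" "ln (c\<^sup>2) = 2 * ln c"
      "ln (\<beta> * x) = ln \<beta> + ln x" "ln (\<beta> * c) = ln \<beta> + ln c" "ln (e * \<beta>\<^sup>2) = ln e + 2 * ln \<beta>"
    using \<beta>_pos x c_pos e by (simp_all add: ln_mult ln_realpow)
  have "psi (curve \<mu>) = - (\<beta>\<^sup>2 * (2 * ln \<beta>)) + (real l - 1) * (x\<^sup>2 * (2 * ln x))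
      + 2 * (real l - 1) * ((\<beta> * x) * (ln \<beta> + ln x))
      + real l * (- (e * \<beta>\<^sup>2 * (2 * ln \<beta>)) - 2 * (\<beta> * c * (ln \<beta> + ln c)) - c\<^sup>2 * (2 * ln c) / real d)"
    unfolding psi_split fst snd none single gap free ln by (simp add: algebra_simps)
  also have "\<dots> = 2 * (ln \<beta> * (- \<beta>\<^sup>2 + (real l - 1) * (\<beta> * x) - real l * (e * \<beta>\<^sup>2 + \<beta> * c))
      + ln x * (real l - 1) * (x\<^sup>2 + \<beta> * x) - real l * ln c * (\<beta> * c + c\<^sup>2 / real d))"
    by (simp add: algebra_simps)
  also have "- \<beta>\<^sup>2 + (real l - 1) * (\<beta> * x) - real l * (e * \<beta>\<^sup>2 + \<beta> * c) = - \<beta>"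
    by (simp add: x_def c_def d_eq algebra_simps power2_eq_square)
  also have "x\<^sup>2 + \<beta> * x = x" by (simp add: x_def algebra_simps power2_eq_square)
  also have "\<beta> * c + c\<^sup>2 / real d = c / real d"
  proof -
    have "\<beta> * c + c\<^sup>2 / real d = c * (real d * \<beta> + c) / real d"
      using d_pos by (simp add: field_simps power2_eq_square)
    then show ?thesis by (simp add: c)
  qed
  also have "2 * (ln \<beta> * - \<beta> + ln x * (real l - 1) * x - real l * ln c * (c / real d)) = 2 * Phi d l \<beta>"
    unfolding Phi_def c_def[symmetric] x_def[symmetric] by (simp add: algebra_simps)
  finally show ?thesis .
qed

text \<open>Both \<open>gap\<close> and \<open>free\<close> depend only on
  \<open>\<rho> + \<theta> / l\<close>, so together they contribute \<open>- Y\<close> times the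
  rank-one matrix with entries \<open>l\<close>, 1, 1, \<open>1 / l\<close>.\<close>

lemma has_hessian_psi:
  assumes "p \<in> R_region d l \<beta>"
  defines "Y \<equiv> 2 / gap p + real d / free p"
  shows "has_hessian psi
    (\<lambda>h. ((- 1 / fst p + (real l - 1) / (1 - 2 * \<beta> + fst p) + 2 * (real l - 1) / (\<beta> - fst p) - real l * Y) * fst h
           + (- Y) * snd h,
          (- Y) * fst h + (- 1 / snd p - Y / real l) * snd h)) p"
  unfolding has_hessian_def
proof (intro exI conjI)
  have "\<forall>\<^sub>F y in nhds p. y \<in> R_region d l \<beta>"
    using assms open_region by (intro eventually_nhds_in_open) auto
  then show "\<forall>\<^sub>F y in nhds p. GDERIV psi y :> grad y"
    by eventually_elim (simp add: gderiv_def has_derivative_psi)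
  have pos: "0 < fst p" "fst p < \<beta>" "0 < snd p" "0 < gap p" "0 < free p"
    using assms by (auto simp: region_iff)
  have none: "0 < 1 - 2 * \<beta> + fst p" using pos \<beta>_le_half by simp
  have t1: "((\<lambda>p. ln (fst p)) has_derivative (\<lambda>h. fst h * (1 / fst p))) (at p)"
    using pos by (auto intro!: derivative_eq_intros simp: divide_inverse)
  have t3: "((\<lambda>p. ln (1 - 2 * \<beta> + fst p)) has_derivative (\<lambda>h. fst h * (1 / (1 - 2 * \<beta> + fst p)))) (at p)"
    using none by (auto intro!: derivative_eq_intros simp: divide_inverse)
  have t4: "((\<lambda>p. ln (\<beta> - fst p)) has_derivative (\<lambda>h. - fst h * (1 / (\<beta> - fst p)))) (at p)"
    using pos by (auto intro!: derivative_eq_intros simp: divide_inverse)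
  have t2: "((\<lambda>p. ln (snd p / real l)) has_derivative (\<lambda>h. snd h * (1 / snd p))) (at p)"
    using pos l_pos by (auto intro!: derivative_eq_intros simp: inverse_eq_divide)
  have t5: "((\<lambda>p. ln (gap p)) has_derivative (\<lambda>h. (- fst h - snd h / real l) * (1 / gap p))) (at p)"
    by (rule has_derivative_ln_compose[OF has_derivative_gap pos(4)])
  have t6: "((\<lambda>p. ln (free p)) has_derivative
      (\<lambda>h. (fst h * real d + snd h * real d / real l) * (1 / free p))) (at p)"
    by (rule has_derivative_ln_compose[OF has_derivative_free pos(5)])
  have "(grad has_derivative (\<lambda>h.
      (- (fst h * (1 / fst p)) + (real l - 1) * (fst h * (1 / (1 - 2 * \<beta> + fst p)))
         - 2 * (real l - 1) * (- fst h * (1 / (\<beta> - fst p)))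
         + 2 * real l * ((- fst h - snd h / real l) * (1 / gap p))
         - real l * ((fst h * real d + snd h * real d / real l) * (1 / free p)),
       0 - snd h * (1 / snd p) + 2 * ((- fst h - snd h / real l) * (1 / gap p))
         - (fst h * real d + snd h * real d / real l) * (1 / free p)))) (at p)"
    unfolding grad_def[abs_def]
    by (intro has_derivative_Pair has_derivative_add has_derivative_diff has_derivative_minus
        has_derivative_mult_right has_derivative_const t1 t2 t3 t4 t5 t6)
  moreover have "(- (fst h * (1 / fst p)) + (real l - 1) * (fst h * (1 / (1 - 2 * \<beta> + fst p)))
         - 2 * (real l - 1) * (- fst h * (1 / (\<beta> - fst p)))
         + 2 * real l * ((- fst h - snd h / real l) * (1 / gap p))
         - real l * ((fst h * real d + snd h * real d / real l) * (1 / free p)))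
      = (- 1 / fst p + (real l - 1) / (1 - 2 * \<beta> + fst p) + 2 * (real l - 1) / (\<beta> - fst p) - real l * Y) * fst h
           + (- Y) * snd h" for h
  proof -
    have 1: "2 * real l * ((- fst h - snd h / real l) * (1 / gap p))
        = (- real l * fst h - snd h) * (2 / gap p)" using l_pos pos by (simp add: field_simps)
    have 2: "real l * ((fst h * real d + snd h * real d / real l) * (1 / free p))
        = (real l * fst h + snd h) * (real d / free p)" using l_pos pos by (simp add: field_simps)
    show ?thesis unfolding 1 2 Y_def by (simp add: algebra_simps add_divide_distrib diff_divide_distrib)
  qed
  moreover have "0 - snd h * (1 / snd p) + 2 * ((- fst h - snd h / real l) * (1 / gap p))
         - (fst h * real d + snd h * real d / real l) * (1 / free p)
      = (- Y) * fst h + (- 1 / snd p - Y / real l) * snd h" for h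
    unfolding Y_def by (simp add: add_divide_distrib algebra_simps)
  ultimately show "(grad has_derivative (\<lambda>h.
      ((- 1 / fst p + (real l - 1) / (1 - 2 * \<beta> + fst p) + 2 * (real l - 1) / (\<beta> - fst p) - real l * Y) * fst h
           + (- Y) * snd h,
          (- Y) * fst h + (- 1 / snd p - Y / real l) * snd h))) (at p)"
    by simp
qed

lemma r_param_eq: "r_param d l \<beta> = e * (real l - 1) * \<mu>\<^sup>2 / (1 + e * \<mu>)\<^sup>2"
proof -
  have "1 - \<beta> = c * (1 + e * \<mu>)"
    using c_\<mu> unfolding d_eq by (subst \<beta>_eq) (simp add: algebra_simps)
  then have "\<beta> / (1 - \<beta>) = \<mu> / (1 + e * \<mu>)" using c_pos by (simp add: \<mu>_def)
  then show ?thesis by (simp add: r_param_def e_def power_divide)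
qed

text \<open>The lower diagonal entry is clearly negative, so only the determinant matters. Up to
  positive factors its positivity is \<open>(l - 1) * e * \<beta>\<^sup>2 < x\<^sup>2\<close>, the
  hypothesis on \<open>r_param\<close>.\<close>

lemma negative_definite_hessian_psi:
  assumes "r_param d l \<beta> < 1"
  shows "\<exists>H. has_hessian psi H (curve \<mu>) \<and> negative_definite H"
proof -
  define x where "x = 1 - \<beta>"
  define Y where "Y = 2 / gap (curve \<mu>) + real d / free (curve \<mu>)"
  define A where "A = - 1 / fst (curve \<mu>) + (real l - 1) / (1 - 2 * \<beta> + fst (curve \<mu>))
    + 2 * (real l - 1) / (\<beta> - fst (curve \<mu>)) - real l * Y"
  define C where "C = - 1 / snd (curve \<mu>) - Y / real l"
  have x: "0 < x" using \<beta>_le_half \<beta>_pos by (simp add: x_def)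
  have e: "0 < e" using e_ge by simp
  have inv: "1 + real d * \<mu> = 1 / c" using c_\<mu> c_pos by (simp add: field_simps)
  have gap: "gap (curve \<mu>) = \<beta> * c"
    using gap_curve[OF \<mu>_pos] unfolding inv using c_pos by (simp add: \<mu>_def)
  have free: "free (curve \<mu>) = c\<^sup>2"
    using free_curve[OF \<mu>_pos] unfolding inv using c_pos by (simp add: power2_eq_square)
  have db: "real d * \<beta> = 1 - c" by (simp add: c_def)
  have Y: "Y * \<beta>\<^sup>2 = \<beta> * (1 + c) / c\<^sup>2"
  proof -
    have "Y * \<beta>\<^sup>2 = \<beta> * (2 * c + real d * \<beta>) / c\<^sup>2"
      unfolding Y_def gap free using c_pos \<beta>_pos by (simp add: field_simps power2_eq_square)
    then show ?thesis by (simp add: db)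
  qed
  have Y_pos: "0 < Y" unfolding Y_def gap free using c_pos \<beta>_pos d_pos by (intro add_pos_pos) auto
  have "0 < 1 / snd (curve \<mu>)" "0 < Y / real l"
    using curve_\<mu>_in_region Y_pos l_pos by (simp_all add: region_iff)
  then have C: "C < 0" unfolding C_def by linarith
  \<comment> \<open>All Hessian entries are scaled by \<open>\<beta>\<^sup>2\<close>; then
    \<open>Z\<close> obeys the simple relation \<open>Zd\<close>, and the determinant changes only
    by a positive factor.\<close>
  define Z where "Z = Y * \<beta>\<^sup>2"
  have C2: "C * \<beta>\<^sup>2 = - (1 / e + Z) / real l"
    using e l_pos \<beta>_pos by (simp add: C_def curve_\<mu> Z_def field_simps)
  have A2: "A * \<beta>\<^sup>2 = - real l + (real l - 1) / x\<^sup>2 - real l * Z"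
  proof -
    have none: "1 - 2 * \<beta> + \<beta>\<^sup>2 = x\<^sup>2" by (simp add: x_def power2_eq_square algebra_simps)
    have single: "\<beta> - \<beta>\<^sup>2 = \<beta> * x" by (simp add: x_def power2_eq_square algebra_simps)
    have "A * \<beta>\<^sup>2 = - 1 + (real l - 1) * (\<beta>\<^sup>2 / x\<^sup>2 + 2 * \<beta> / x) - real l * Z"
      unfolding A_def curve_\<mu> fst_conv none single Z_def using x \<beta>_pos
      by (simp add: field_simps power2_eq_square)
    also have "\<beta>\<^sup>2 / x\<^sup>2 + 2 * \<beta> / x = 1 / x\<^sup>2 - 1"
    proof -
      have "\<beta>\<^sup>2 / x\<^sup>2 + 2 * \<beta> / x = (\<beta>\<^sup>2 + 2 * \<beta> * x) / x\<^sup>2"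
        using x by (simp add: field_simps power2_eq_square)
      also have "\<beta>\<^sup>2 + 2 * \<beta> * x = 1 - x\<^sup>2" by (simp add: x_def power2_eq_square algebra_simps)
      finally show ?thesis using x by (simp add: diff_divide_distrib)
    qed
    finally show ?thesis by (simp add: algebra_simps)
  qed
  have r_less: "(real l - 1) * e * \<beta>\<^sup>2 < x\<^sup>2"
    using assms x by (simp add: r_param_def e_def x_def[symmetric] power_divide field_simps)
  \<comment> \<open>This is \<open>r_less\<close> with \<open>(l - 1) * x\<^sup>2\<close> added to
    both sides, because
    \<open>x\<^sup>2 + e * \<beta>\<^sup>2 = (c\<^sup>2 + e) / d\<close>.\<close>
  have key: "(real l - 1) * (c\<^sup>2 + e) / real d < real l * x\<^sup>2"
  proof -
    have "c\<^sup>2 + e = real d * (x\<^sup>2 + e * \<beta>\<^sup>2)"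
      by (simp add: c_def x_def d_eq algebra_simps power2_eq_square)
    then have "(real l - 1) * (c\<^sup>2 + e) / real d = (real l - 1) * (x\<^sup>2 + e * \<beta>\<^sup>2)"
      using d_pos by simp
    then show ?thesis using r_less by (simp add: algebra_simps)
  qed
  have Zd: "1 + real d * Z = 1 / c\<^sup>2"
  proof -
    have "real d * Z = (real d * \<beta>) * (1 + c) / c\<^sup>2" unfolding Z_def Y by simp
    then have "real d * Z = (1 - c\<^sup>2) / c\<^sup>2" unfolding db by (simp add: algebra_simps power2_eq_square)
    then show ?thesis using c_pos by (simp add: diff_divide_distrib)
  qed
  have "Z\<^sup>2 < (A * \<beta>\<^sup>2) * (C * \<beta>\<^sup>2)"
  proof -
    \<comment> \<open>Chosen so that \<open>A * \<beta>\<^sup>2 = - l * (1 + Z - M)\<close>.\<close>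
    define M where "M = (real l - 1) / (real l * x\<^sup>2)"
    have "real d * (1 + e * Z) = (c\<^sup>2 + e) / c\<^sup>2"
    proof -
      have "real d * (1 + e * Z) = 1 + e * (1 + real d * Z)" by (simp add: d_eq algebra_simps)
      then show ?thesis unfolding Zd using c_pos by (simp add: add_divide_distrib)
    qed
    moreover have "1 + e * Z = (real d * (1 + e * Z)) / real d" using d_pos by simp
    ultimately have "1 + e * Z = (c\<^sup>2 + e) / real d / c\<^sup>2" by (simp add: mult.commute)
    then have "M * (1 + e * Z) = (real l - 1) * (c\<^sup>2 + e) / real d / (real l * x\<^sup>2) / c\<^sup>2"
      by (simp add: M_def)
    also have "\<dots> < 1 / c\<^sup>2"
      using divide_strict_right_mono[OF key, of "real l * x\<^sup>2"] l_pos x c_pos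
      by (intro divide_strict_right_mono) simp_all
    finally have "M * (1 + e * Z) < 1 + real d * Z" unfolding Zd .
    \<comment> \<open>The terms in \<open>e * Z\<^sup>2\<close> cancel, so this is just
      \<open>1 + d * Z - M * (1 + e * Z)\<close>.\<close>
    then have "0 < ((1 + Z - M) * (1 + e * Z) - e * Z\<^sup>2)"
      by (simp add: d_eq algebra_simps power2_eq_square)
    then have "0 < ((1 + Z - M) * (1 + e * Z) - e * Z\<^sup>2) / e" using e by simp
    also have "\<dots> = (1 + Z - M) * (1 / e + Z) - Z\<^sup>2" using e by (simp add: field_simps)
    also have "(1 + Z - M) * (1 / e + Z) = (A * \<beta>\<^sup>2) * (C * \<beta>\<^sup>2)"
    proof -
      have "(real l - 1) / x\<^sup>2 = real l * M" using l_pos by (simp add: M_def)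
      then have A': "A * \<beta>\<^sup>2 = - real l * (1 + Z - M)" unfolding A2 by (simp add: algebra_simps)
      have "X * W = (- real l * X) * (- W / real l)" for X W :: real using l_pos by simp
      then show ?thesis unfolding A' C2 .
    qed
    finally show ?thesis by simp
  qed
  then have "(Y\<^sup>2) * (\<beta>\<^sup>2 * \<beta>\<^sup>2) < (A * C) * (\<beta>\<^sup>2 * \<beta>\<^sup>2)"
    by (simp add: Z_def power_mult_distrib mult_ac power2_eq_square)
  then have "(- Y)\<^sup>2 < A * C" using \<beta>_pos by (simp add: mult_less_cancel_right)
  with C have "negative_definite (\<lambda>h :: real \<times> real. (A * fst h + (- Y) * snd h, (- Y) * fst h + C * snd h))"
    by (rule negative_definite_matrix)
  moreover have "has_hessian psi (\<lambda>h. (A * fst h + (- Y) * snd h, (- Y) * fst h + C * snd h)) (curve \<mu>)"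
    using has_hessian_psi[OF curve_\<mu>_in_region] unfolding A_def C_def Y_def .
  ultimately show ?thesis by blast
qed

end

subsection \<open>Monotonicity along the curve\<close>

text \<open>The earlier algebra and the Hessian criterion need only \<open>d * \<beta> < 1\<close>.
  The added bound determines the sign of the derivative along the curve and yields
  \<open>r_param d l \<beta> < 1\<close>.\<close>

locale sparse_overlap_optimization = overlap_optimization +
  assumes tilt_bound: "(1 + e * \<mu>) ^ (l - 1) < sqrt (real d)"
begin

text \<open>Bernoulli applied to \<open>tilt_bound\<close>, weakened by
  \<open>sqrt d \<le> d = 1 + e\<close>; the factor \<open>e\<close> then cancels.\<close>

lemma l_\<mu>_le: "real (l - 1) * \<mu> \<le> 1"
proof -
  have "1 + real (l - 1) * (e * \<mu>) \<le> (1 + e * \<mu>) ^ (l - 1)"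
    using e_ge \<mu>_pos by (intro Bernoulli_inequality) (auto intro: order_trans[of _ 0])
  also have "\<dots> \<le> sqrt (real d)" using tilt_bound by simp
  also have "\<dots> \<le> sqrt ((real d)\<^sup>2)"
    using d by (intro real_sqrt_le_mono) (simp add: power2_eq_square)
  also have "\<dots> = 1 + e" using d_eq by simp
  finally have "e * (real (l - 1) * \<mu>) \<le> e * 1" by (simp add: mult_ac)
  then show ?thesis using e_ge by simp
qed

lemma r_param_less: "r_param d l \<beta> < 1"
proof -
  have "(real l - 1) * \<mu> \<le> 1" using l_\<mu>_le l by simp
  then have "((real l - 1) * \<mu>) * (e * \<mu>) \<le> 1 * (e * \<mu>)"
    using e_ge \<mu>_pos by (intro mult_right_mono) auto
  also have "\<dots> < (1 + e * \<mu>)\<^sup>2"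
    using e_ge \<mu>_pos by (simp add: power2_eq_square algebra_simps add_pos_pos)
  finally have "e * (real l - 1) * \<mu>\<^sup>2 < (1 + e * \<mu>)\<^sup>2" by (simp add: power2_eq_square mult_ac)
  moreover have "0 < 1 + e * \<mu>" using e_ge \<mu>_pos by (simp add: add_pos_pos)
  ultimately show ?thesis unfolding r_param_eq by simp
qed

text \<open>After taking logarithms, the two ratio lemmas fix the sign of the gradient component on
  each side of \<open>\<mu>\<close>; \<open>rate\<close> says that \<open>\<rho>\<close> decreases
  along the curve.\<close>

lemma psi_curve_less:
  assumes v: "0 < v" "v \<noteq> \<mu>" and "curve v \<in> R_region d l \<beta>"
  shows "psi (curve v) < psi (curve \<mu>)"
proof -
  have rate: "0 < c * (1 + 2 * e * w + e * real d * w\<^sup>2) / (1 + real d * w)\<^sup>2" if "0 < w" for w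
    using that e_ge c_pos denominator_pos[OF that]
    by (intro divide_pos_pos mult_pos_pos add_pos_nonneg zero_less_power) auto
  have dom: "0 < v\<^sup>2 + (\<mu> - v) * (1 + real d * v)" using assms curve_in_region_iff by blast
  have ratio: "0 < 1 + (\<mu> - w) * (1 + real d * w) / w\<^sup>2" if "curve w \<in> R_region d l \<beta>" "0 < w" for w
  proof -
    have "0 < (w\<^sup>2 + (\<mu> - w) * (1 + real d * w)) / w\<^sup>2" using curve_in_region_iff that by simp
    then show ?thesis using that by (simp add: add_divide_distrib)
  qed
  consider "v < \<mu>" | "\<mu> < v" using v by linarith
  then show ?thesis
  proof cases
    case 1
    \<comment> \<open>Left of \<open>\<mu>\<close> both summands in the region criterion are
      nonnegative and the square is positive.\<close>
    have reg: "curve w \<in> R_region d l \<beta>" if "v \<le> w" "w \<le> \<mu>" for w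
      using that v d_pos by (subst curve_in_region_iff) (auto intro!: add_pos_nonneg)
    show ?thesis
    proof (rule DERIV_pos_imp_increasing_open[OF 1])
      fix w assume w: "v < w" "w < \<mu>"
      have w0: "0 < w" using w v by simp
      have r: "curve w \<in> R_region d l \<beta>" using reg w by simp
      let ?x = "1 + e * ((\<mu> - w) * (1 + real d * w)) / (1 + e * w)\<^sup>2"
      let ?y = "1 + (\<mu> - w) * (1 + real d * w) / w\<^sup>2"
      have x: "1 \<le> ?x" using w w0 e_ge d_pos by simp
      have "?x ^ (l - 1) < ?y"
        using tilted_ratio_less[of "real d" e w \<mu> "l - 1"] d w w0 tilt_bound by (simp add: e_def)
      then have "ln (?x ^ (l - 1)) < ln ?y" using x ratio[OF r w0] by (subst ln_less_cancel_iff) auto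
      then have "fst (grad (curve w)) < 0"
        using x unfolding grad_curve(1)[OF w0 r] by (simp add: ln_realpow)
      then have "- (c * (1 + 2 * e * w + e * real d * w\<^sup>2) / (1 + real d * w)\<^sup>2) * fst (grad (curve w)) > 0"
        using mult_pos_neg[OF rate[OF w0]] by (simp only: mult_minus_left neg_0_less_iff_less)
      then show "\<exists>y. ((\<lambda>v. psi (curve v)) has_real_derivative y) (at w) \<and> 0 < y"
        using has_real_derivative_psi_curve[OF w0 r] by blast
    next
      show "continuous_on {v..\<mu>} (\<lambda>v. psi (curve v))"
        using reg v by (intro DERIV_continuous_on[OF has_field_derivative_at_within[OF has_real_derivative_psi_curve]]) auto
    qed
  next
    case 2
    have reg: "curve w \<in> R_region d l \<beta>" if "\<mu> \<le> w" "w \<le> v" for w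
    proof -
      have w0: "0 < w" using that \<mu>_pos by simp
      \<comment> \<open>Divided by \<open>v\<close>, the region criterion becomes a decreasing
        function of \<open>v\<close>; so if it holds at \<open>v\<close>, it holds at every smaller
        \<open>w\<close>.\<close>
      have "0 < \<mu> / v + real d * \<mu> - 1 - e * v"
      proof -
        have "0 < (v\<^sup>2 + (\<mu> - v) * (1 + real d * v)) / v" using dom v by simp
        also have "\<dots> = \<mu> / v + real d * \<mu> - 1 - e * v"
          using v by (simp add: d_eq field_simps power2_eq_square)
        finally show ?thesis .
      qed
      also have "\<dots> \<le> \<mu> / w + real d * \<mu> - 1 - e * w"
        using that w0 \<mu>_pos e_ge v by (intro diff_mono add_mono divide_left_mono mult_left_mono) auto
      also have "\<dots> = (w\<^sup>2 + (\<mu> - w) * (1 + real d * w)) / w"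
        using w0 by (simp add: d_eq field_simps power2_eq_square)
      finally show ?thesis using w0 by (simp add: curve_in_region_iff zero_less_divide_iff)
    qed
    show ?thesis
    proof (rule DERIV_neg_imp_decreasing_open[OF 2])
      fix w assume w: "\<mu> < w" "w < v"
      have w0: "0 < w" using w \<mu>_pos by simp
      have r: "curve w \<in> R_region d l \<beta>" using reg w by simp
      let ?x = "1 + e * ((\<mu> - w) * (1 + real d * w)) / (1 + e * w)\<^sup>2"
      let ?y = "1 + (\<mu> - w) * (1 + real d * w) / w\<^sup>2"
      have y: "0 < ?y" using ratio[OF r w0] .
      have lt: "?y < ?x ^ (l - 1)"
        using tilted_ratio_greater[of "real d" e \<mu> w "l - 1"] d w \<mu>_pos l_\<mu>_le
          curve_in_region_iff[OF w0] r by (simp add: e_def)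
      have x: "0 < ?x"
      proof -
        have "0 < 1 - 2 * \<beta> + fst (curve w)" using r \<beta>_le_half by (auto simp: region_iff)
        then have "0 < (1 + e * w)\<^sup>2 + e * ((\<mu> - w) * (1 + real d * w))"
          unfolding none_curve[OF w0] using c_pos denominator_pos[OF w0]
          by (simp add: zero_less_divide_iff zero_less_mult_iff)
        then have "0 < ((1 + e * w)\<^sup>2 + e * ((\<mu> - w) * (1 + real d * w))) / (1 + e * w)\<^sup>2"
          using denominator_pos[OF w0] by simp
        then show ?thesis using denominator_pos[OF w0] by (simp add: add_divide_distrib)
      qed
      have "ln ?y < ln (?x ^ (l - 1))" using lt x y by (subst ln_less_cancel_iff) auto
      then have "fst (grad (curve w)) > 0"
        using x unfolding grad_curve(1)[OF w0 r] by (simp add: ln_realpow)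
      then have "- (c * (1 + 2 * e * w + e * real d * w\<^sup>2) / (1 + real d * w)\<^sup>2) * fst (grad (curve w)) < 0"
        using mult_pos_pos[OF rate[OF w0]] by (simp only: mult_minus_left neg_less_0_iff_less)
      then show "\<exists>y. ((\<lambda>v. psi (curve v)) has_real_derivative y) (at w) \<and> y < 0"
        using has_real_derivative_psi_curve[OF w0 r] by blast
    next
      show "continuous_on {\<mu>..v} (\<lambda>v. psi (curve v))"
        using reg \<mu>_pos by (intro DERIV_continuous_on[OF has_field_derivative_at_within[OF has_real_derivative_psi_curve]]) auto
    qed
  qed
qed

text \<open>First move to the curve at constant \<open>\<rho>\<close>, then along it to
  \<open>\<mu>\<close>. Each proper move strictly increases \<open>psi\<close>, and at least one is
  proper.\<close>

lemma psi_less_max: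
  assumes p: "p \<in> R_region d l \<beta>" and "p \<noteq> curve \<mu>"
  shows "psi p < psi (curve \<mu>)"
proof -
  obtain v where v: "0 < v" "fst (curve v) = fst p" using ex_curve[OF p] by blast
  have "0 < fst (curve v)" using v p by (simp add: region_iff)
  then have "0 < v\<^sup>2 + (\<mu> - v) * (1 + real d * v)"
    unfolding fst_curve[OF v(1)] using c_pos denominator_pos[OF v(1)]
    by (simp add: zero_less_divide_iff zero_less_mult_iff)
  then have r: "curve v \<in> R_region d l \<beta>" using curve_in_region_iff[OF v(1)] by simp
  have "psi p < psi (curve v)" if "p \<noteq> curve v"
    using psi_less_critical[OF p r _ grad_curve(2)[OF v(1) r] that] v by simp
  moreover have "psi (curve v) < psi (curve \<mu>)" if "v \<noteq> \<mu>"
    using psi_curve_less[OF v(1) that r] .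
  ultimately show ?thesis using assms(2) by (metis less_trans)
qed

end

section \<open>From the strict maximum to supremum, maximizer set and Hessian\<close>

theorem lemma7p4:
  fixes d l :: nat and \<beta> :: real
  assumes "d \<ge> 2" and "l \<ge> 3"
    and "0 < \<beta>" and "\<beta> \<le> L2 d l"
  shows "bdd_above ((\<lambda>(\<rho>, \<theta>). Psi d l \<beta> \<rho> \<theta>) ` R_region d l \<beta>)
    \<and> (SUP (\<rho>, \<theta>) \<in> R_region d l \<beta>. Psi d l \<beta> \<rho> \<theta>) = 2 * Phi d l \<beta>
    \<and> {p. is_arg_max (\<lambda>(\<rho>, \<theta>). Psi d l \<beta> \<rho> \<theta>) (\<lambda>p. p \<in> R_region d l \<beta>) p}
        = {(\<beta>\<^sup>2, real l * (real d - 1) * \<beta>\<^sup>2)}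
    \<and> (\<exists>H. has_hessian (\<lambda>(\<rho>, \<theta>). Psi d l \<beta> \<rho> \<theta>) H (\<beta>\<^sup>2, real l * (real d - 1) * \<beta>\<^sup>2)
          \<and> negative_definite H)
    \<and> r_param d l \<beta> < 1"
proof -
  interpret overlap_optimization d l \<beta>
    using assms L2_tilt_bound by unfold_locales auto
  interpret sparse_overlap_optimization d l \<beta>
    using L2_tilt_bound(2)[OF assms] by unfold_locales (simp add: e_def \<mu>_def c_def)
  have psi: "(\<lambda>(\<rho>, \<theta>). Psi d l \<beta> \<rho> \<theta>) = psi"
    by (auto simp: psi_def)
  have opt: "(\<beta>\<^sup>2, real l * (real d - 1) * \<beta>\<^sup>2) = curve \<mu>"
    by (simp add: curve_\<mu> e_def)
  have max: "psi p \<le> psi (curve \<mu>)" if "p \<in> R_region d l \<beta>" for p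
    using psi_less_max[OF that] by fastforce
  have "bdd_above (psi ` R_region d l \<beta>)" using max by (rule bdd_aboveI2)
  moreover have "(SUP p\<in>R_region d l \<beta>. psi p) = 2 * Phi d l \<beta>"
    unfolding psi_curve_\<mu>[symmetric] using max curve_\<mu>_in_region by (intro cSup_eq_maximum) auto
  moreover have "{p. is_arg_max psi (\<lambda>p. p \<in> R_region d l \<beta>) p} = {curve \<mu>}"
    unfolding is_arg_max_def using psi_less_max curve_\<mu>_in_region max by (blast dest: leD)
  ultimately show ?thesis
    unfolding psi opt using negative_definite_hessian_psi[OF r_param_less] r_param_less by blast
qed

end
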